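(* Let $n\ge1$ and let $\lambda=(\lambda_1\ge\cdots\ge\lambda_\ell>0)$ be a partition of $n$, with $\lambda_j=0$ for $j>\ell$. Let $\mathcal T=\{j: 1\le j\le n,\ \lambda_j>\lambda_{j+1}\}$ and, for $i\in\mathcal T$, let $\lambda^{i-}$ be the partition of $n-1$ obtained from $\lambda$ by removing the rightmost box of the $i$-th row. Then, as an identity of rational functions in the indeterminate $x$, $$\sum_{i\in\mathcal T}\frac{H_\lambda}{H_{\lambda^{i-}}}\cdot\frac{1}{x+\lambda_i-i}=x-\frac{(x-n)\,g_\lambda(x+1)}{g_\lambda(x)}.$$
   Context: For a partition $\lambda$ of $n$, $g_\lambda(x)=\prod_{i=1}^{n}(x+\lambda_i-i)$ with $\lambda_i=0$ for $i>\ell(\lambda)$. For a box $(i,j)$ of the Ferrers diagram of a partition $\nu$, its hook length is $(\nu_i-j)+(\nu'_j-i)+1$ where $\nu'_j=\#\{k:\nu_k\ge j\}$; $H_\nu$ is the product of the hook lengths of all boxes of $\nu$. *)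

theory Defs
  imports
    "HOL-Computational_Algebra.Polynomial"
    "HOL-Computational_Algebra.Fraction_Field"
begin

text \<open>A partition is the weakly decreasing list of its positive parts.\<close>

definition is_partition :: "nat \<Rightarrow> nat list \<Rightarrow> bool" where
  "is_partition n \<mu> \<longleftrightarrow> sorted_wrt (\<ge>) \<mu> \<and> (\<forall>p\<in>set \<mu>. p > 0) \<and> sum_list \<mu> = n"

text \<open>Rows are numbered from 1, and \<open>part \<mu> i = 0\<close> for \<open>i > length \<mu>\<close>.\<close>

definition part :: "nat list \<Rightarrow> nat \<Rightarrow> nat" where
  "part \<mu> i = (if 1 \<le> i \<and> i \<le> length \<mu> then \<mu> ! (i - 1) else 0)"

definition conj_part :: "nat list \<Rightarrow> nat \<Rightarrow> nat" where
  "conj_part \<nu> j = card {k. 1 \<le> k \<and> part \<nu> k \<ge> j}"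

definition boxes :: "nat list \<Rightarrow> (nat \<times> nat) set" where
  "boxes \<nu> = {(i, j). 1 \<le> i \<and> i \<le> length \<nu> \<and> 1 \<le> j \<and> j \<le> part \<nu> i}"

text \<open>On boxes of a partition neither subtraction truncates.\<close>

definition hook_length :: "nat list \<Rightarrow> nat \<Rightarrow> nat \<Rightarrow> nat" where
  "hook_length \<nu> i j = (part \<nu> i - j) + (conj_part \<nu> j - i) + 1"

definition hook_product :: "nat list \<Rightarrow> nat" where
  "hook_product \<nu> = (\<Prod>(i, j)\<in>boxes \<nu>. hook_length \<nu> i j)"

definition removable_rows :: "nat list \<Rightarrow> nat set" where
  "removable_rows \<mu> = {j. 1 \<le> j \<and> j \<le> sum_list \<mu> \<and> part \<mu> j > part \<mu> (j + 1)}"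

text \<open>A row of length 1 becomes empty and is dropped from the list.\<close>

definition remove_box :: "nat list \<Rightarrow> nat \<Rightarrow> nat list" where
  "remove_box \<mu> i = filter (\<lambda>p. p > 0) (\<mu>[i - 1 := part \<mu> i - 1])"

text \<open>The polynomial \<open>g\<^sub>\<mu>\<close> as a function on an arbitrary commutative ring.\<close>

definition g_poly :: "nat list \<Rightarrow> 'a::comm_ring_1 \<Rightarrow> 'a" where
  "g_poly \<mu> x = (\<Prod>i=1..sum_list \<mu>. x + of_nat (part \<mu> i) - of_nat i)"

text \<open>The indeterminate of the field of rational functions over the rationals.\<close>

definition indet :: "rat poly fract" where
  "indet = Fract [:0, 1:] 1"

end

theory Submission imports Defs begin

text \<open>
  Put \<open>a\<^sub>i = \<lambda>\<^sub>i - i\<close>, which are distinct. The right-hand side vanishes at infinity, so it is the sum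
  of its polar parts; its residue at \<open>-a\<^sub>i\<close> is \<open>(n + a\<^sub>i) \<Prod>\<^bsub>j\<noteq>i\<^esub> (a\<^sub>j + 1 - a\<^sub>i) / (a\<^sub>j - a\<^sub>i)\<close>.
  This is \<open>0\<close> unless row \<open>i\<close> is removable, because otherwise \<open>a\<^bsub>i+1\<^esub> = a\<^sub>i - 1\<close> (or \<open>i = n\<close> and
  \<open>a\<^sub>n = -n\<close>). For removable \<open>i\<close> it equals \<open>H\<^sub>\<lambda> / H\<^bsub>\<lambda>\<^sup>i\<^sup>-\<^esub>\<close> by Frobenius' formula
  \<open>H\<^sub>\<lambda> \<Prod>\<^bsub>i<j\<^esub> (a\<^sub>i - a\<^sub>j) = \<Prod>\<^sub>i (a\<^sub>i + n)!\<close>, applied to both diagrams padded with zero rows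
  to \<open>n\<close> rows.
\<close>

section \<open>Partial fractions\<close>

text \<open>\<open>c I i\<close> is the residue of the product at \<open>- a i\<close>; the
  induction adjoins one factor at a time. The second conjunct compares the coefficients of 1/x at
  infinity, and its inductive step uses the first conjunct at \<open>x = - a k\<close>. The
  pointwise form over any field allows \<open>x\<close> to be the indeterminate later.\<close>

lemma partial_fractions_monic:
  fixes a b :: "'i \<Rightarrow> 'a::field"
  assumes "finite I" "inj_on a I"
  defines "c \<equiv> \<lambda>J i. (\<Prod>j\<in>J. b j - a i) / (\<Prod>j\<in>J - {i}. a j - a i)"
  shows "(\<forall>x. (\<forall>i\<in>I. x + a i \<noteq> 0) \<longrightarrow>
            (\<Prod>i\<in>I. (x + b i) / (x + a i)) = 1 + (\<Sum>i\<in>I. c I i / (x + a i)))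
         \<and> (\<Sum>i\<in>I. c I i) = (\<Sum>i\<in>I. b i - a i)"
  using assms(1,2)
proof (induction I rule: finite_induct)
  case empty
  then show ?case by simp
next
  case (insert k I)
  define d where "d = b k - a k"
  have inj: "inj_on a I" and ak: "\<And>i. i \<in> I \<Longrightarrow> a i \<noteq> a k"
    using insert.prems insert.hyps by (auto simp: inj_on_def)
  note IH = insert.IH[OF inj]
  \<comment> \<open>A new factor multiplies each old residue by its value at
    \<open>- a i\<close>.\<close>
  have ci: "c (insert k I) i = c I i * (b k - a i) / (a k - a i)" if "i \<in> I" for i
  proof -
    have "insert k I - {i} = insert k (I - {i})" using that insert.hyps by auto
    then show ?thesis using that insert.hyps by (simp add: c_def mult.commute)
  qed
  \<comment> \<open>The residue at the new pole is \<open>d\<close> times the old product at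
    \<open>- a k\<close>, where the induction hypothesis applies because \<open>a\<close> is
    injective.\<close>
  have "c (insert k I) k = d * (\<Prod>i\<in>I. (- a k + b i) / (- a k + a i))"
    using insert.hyps by (simp add: c_def d_def prod_dividef)
  also have "(\<Prod>i\<in>I. (- a k + b i) / (- a k + a i)) = 1 + (\<Sum>i\<in>I. c I i / (- a k + a i))"
    using conjunct1[OF IH, rule_format, of "- a k"] ak by simp
  finally have ck: "c (insert k I) k = d * (1 + (\<Sum>i\<in>I. c I i / (a i - a k)))"
    by simp
  have expand: "(\<Prod>i\<in>insert k I. (x + b i) / (x + a i))
      = 1 + (\<Sum>i\<in>insert k I. c (insert k I) i / (x + a i))"
    if x: "\<forall>i\<in>insert k I. x + a i \<noteq> 0" for x
  proof -
    have xk: "x + a k \<noteq> 0" using x by simp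
    \<comment> \<open>Each old polar term times the new factor has just the two simple poles
      \<open>- a i\<close> and \<open>- a k\<close>.\<close>
    have split: "c I i / (x + a i) * ((x + b k) / (x + a k))
        = c (insert k I) i / (x + a i) + d * (c I i / (a i - a k)) / (x + a k)" if "i \<in> I" for i
    proof -
      have "x + a i \<noteq> 0" "a i - a k \<noteq> 0" "a k - a i \<noteq> 0" using x ak[OF that] that by auto
      then have "(x + b k) / ((x + a i) * (x + a k))
          = (b k - a i) / ((a k - a i) * (x + a i)) + d / ((a i - a k) * (x + a k))"
        using xk by (simp add: divide_simps d_def) (simp add: algebra_simps)
      from arg_cong[OF this, of "\<lambda>t. c I i * t"] show ?thesis
        by (simp add: ci[OF that] algebra_simps)
    qed
    have "(\<Prod>i\<in>insert k I. (x + b i) / (x + a i))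
        = (1 + (\<Sum>i\<in>I. c I i / (x + a i))) * ((x + b k) / (x + a k))"
      using insert.hyps IH x by (simp add: mult.commute)
    also have "\<dots> = (x + b k) / (x + a k) + (\<Sum>i\<in>I. c I i / (x + a i) * ((x + b k) / (x + a k)))"
      by (simp only: distrib_right sum_distrib_right mult_1)
    also have "\<dots> = (x + b k) / (x + a k) + (\<Sum>i\<in>I. c (insert k I) i / (x + a i))
        + d * (\<Sum>i\<in>I. c I i / (a i - a k)) / (x + a k)"
      by (simp only: sum.cong[OF refl split] sum.distrib sum_distrib_left sum_divide_distrib add.assoc)
    also have "(x + b k) / (x + a k) = 1 + d / (x + a k)"
      using xk by (simp add: d_def field_simps)
    finally show ?thesis
      using insert.hyps by (simp add: ck distrib_left add_divide_distrib)
  qed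
  have total: "(\<Sum>i\<in>insert k I. c (insert k I) i) = (\<Sum>i\<in>insert k I. b i - a i)"
  proof -
    \<comment> \<open>This is the comparison of 1/x coefficients at infinity in the splitting
      above.\<close>
    have "c (insert k I) i + d * (c I i / (a i - a k)) = c I i" if "i \<in> I" for i
    proof -
      have "a i - a k \<noteq> 0" "a k - a i \<noteq> 0" using ak[OF that] by auto
      then have "(b k - a i) / (a k - a i) + d / (a i - a k) = 1"
        by (simp add: divide_simps d_def) (simp add: algebra_simps)
      from arg_cong[OF this, of "\<lambda>t. c I i * t"] show ?thesis
        by (simp add: ci[OF that] algebra_simps)
    qed
    then have "(\<Sum>i\<in>I. c (insert k I) i) + d * (\<Sum>i\<in>I. c I i / (a i - a k)) = (\<Sum>i\<in>I. c I i)"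
      by (simp add: sum_distrib_left flip: sum.distrib)
    then show ?thesis
      using insert.hyps IH by (simp add: ck d_def algebra_simps)
  qed
  show ?case using expand total by blast
qed

section \<open>Hook products and Frobenius' formula\<close>

text \<open>
  The hook lengths in row \<open>i\<close> and the differences \<open>a\<^sub>i - a\<^sub>k\<close>, \<open>k > i\<close>, partition \<open>{1..a\<^sub>i + N}\<close>:
  they are distinct, lie in that interval, and have the right number.
\<close>

lemma row_hook_complement:
  fixes p :: "nat \<Rightarrow> nat"
  assumes anti: "\<And>r s. 1 \<le> r \<Longrightarrow> r \<le> s \<Longrightarrow> p s \<le> p r"
    and zero: "\<And>r. N < r \<Longrightarrow> p r = 0"
    and i: "1 \<le> i" "i \<le> N"
  defines "q \<equiv> \<lambda>j. card {k. 1 \<le> k \<and> j \<le> p k}"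
  shows "(\<Prod>j=1..p i. p i - j + (q j - i) + 1) * (\<Prod>k\<in>{i<..N}. p i + k - (p k + i))
    = fact (p i + N - i)"
proof -
  define h where "h = (\<lambda>j. p i - j + (q j - i) + 1)"
  define e where "e = (\<lambda>k. p i + k - (p k + i))"
  \<comment> \<open>Since \<open>p\<close> decreases, the set counted by \<open>q j\<close> is the
    initial segment \<open>{1..q j}\<close>. The bounds and the monotonicity of \<open>q\<close> all
    come from this equivalence.\<close>
  have q_iff: "k \<le> q j \<longleftrightarrow> j \<le> p k" if "1 \<le> j" "1 \<le> k" for j k
  proof -
    let ?S = "{k. 1 \<le> k \<and> j \<le> p k}"
    have fin: "finite ?S"
      by (rule finite_subset[of _ "{1..N}"]) (use zero that in \<open>force simp: not_less\<close>)+
    show ?thesis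
    proof
      assume "j \<le> p k"
      then have "{1..k} \<subseteq> ?S" using anti by force
      from card_mono[OF fin this] show "k \<le> q j" by (simp add: q_def)
    next
      assume kq: "k \<le> q j"
      show "j \<le> p k"
      proof (rule ccontr)
        assume "\<not> j \<le> p k"
        moreover have "p r \<le> p k" if "k \<le> r" for r using anti[of k r] that \<open>1 \<le> k\<close> by simp
        ultimately have "?S \<subseteq> {1..<k}" by (auto simp: not_le) (meson le_trans not_less)
        from card_mono[OF _ this] have "q j \<le> k - 1" by (simp add: q_def)
        with kq that show False by simp
      qed
    qed
  qed
  have qN: "q j \<le> N" if "1 \<le> j" for j
    using q_iff[of j "Suc N"] zero[of "Suc N"] that by auto
  have qi: "i \<le> q j" if "j \<in> {1..p i}" for j
    using q_iff[of j i] that i by auto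
  have q_anti: "q j' \<le> q j" if "1 \<le> j" "j \<le> j'" for j j'
  proof (cases "q j' = 0")
    case False
    then show ?thesis using q_iff[of j' "q j'"] q_iff[of j "q j'"] that by auto
  qed simp
  have pk: "p k \<le> p i" if "k \<in> {i<..N}" for k using anti[of i k] i that by auto
  have h_anti: "h j' < h j" if "j \<in> {1..p i}" "j' \<in> {1..p i}" "j < j'" for j j'
    using q_anti[of j j'] that unfolding h_def by auto
  have injh: "inj_on h {1..p i}"
    using h_anti by (metis inj_onI less_irrefl linorder_neqE_nat)
  have e_mono: "e k < e k'" if "k \<in> {i<..N}" "k' \<in> {i<..N}" "k < k'" for k k'
    using anti[of k k'] pk[of k] pk[of k'] that unfolding e_def by auto
  have inje: "inj_on e {i<..N}"
    using e_mono by (metis inj_onI less_irrefl linorder_neqE_nat)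
  have disj: "h ` {1..p i} \<inter> e ` {i<..N} = {}"
  proof -
    \<comment> \<open>If \<open>j \<le> p k\<close>, then \<open>k \<le> q j\<close> and
      \<open>h j > e k\<close>; otherwise \<open>q j < k\<close> and
      \<open>h j < e k\<close>.\<close>
    have "h j \<noteq> e k" if "j \<in> {1..p i}" "k \<in> {i<..N}" for j k
      using q_iff[of j k] qi[of j] pk[of k] that unfolding h_def e_def by (cases "j \<le> p k") auto
    then show ?thesis by blast
  qed
  have sub: "h ` {1..p i} \<union> e ` {i<..N} \<subseteq> {1..p i + N - i}"
  proof -
    have "h j \<in> {1..p i + N - i}" if "j \<in> {1..p i}" for j
      using qN[of j] qi[of j] that i unfolding h_def by auto
    moreover have "e k \<in> {1..p i + N - i}" if "k \<in> {i<..N}" for k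
      using pk[of k] that i unfolding e_def by auto
    ultimately show ?thesis by blast
  qed
  have "card (h ` {1..p i} \<union> e ` {i<..N}) = p i + (N - i)"
    using disj by (simp add: card_Un_disjoint card_image injh inje del: One_nat_def)
  then have un: "h ` {1..p i} \<union> e ` {i<..N} = {1..p i + N - i}"
    using sub i by (intro card_subset_eq) auto
  have "(\<Prod>j=1..p i. h j) * (\<Prod>k\<in>{i<..N}. e k) = \<Prod>(h ` {1..p i}) * \<Prod>(e ` {i<..N})"
    by (simp add: prod.reindex injh inje del: One_nat_def)
  also have "\<dots> = \<Prod>{1..p i + N - i}"
    using disj by (simp flip: un add: prod.union_disjoint del: One_nat_def)
  also have "\<dots> = fact (p i + N - i)" by (simp add: fact_prod)
  finally show ?thesis unfolding h_def e_def .
qed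

lemma hook_product_rows:
  assumes "length \<mu> \<le> N"
  shows "hook_product \<mu> = (\<Prod>i=1..N. \<Prod>j=1..part \<mu> i. hook_length \<mu> i j)"
proof -
  have "boxes \<mu> = Sigma {1..N} (\<lambda>i. {1..part \<mu> i})"
    using assms by (auto simp: boxes_def part_def split: if_splits)
  then show ?thesis by (simp add: hook_product_def prod.Sigma)
qed

lemma part_antimono:
  assumes "is_partition n \<mu>" "1 \<le> r" "r \<le> s"
  shows "part \<mu> s \<le> part \<mu> r"
  using assms by (cases "r = s") (auto simp: is_partition_def part_def sorted_wrt_iff_nth_less)

lemma length_le_size:
  assumes "is_partition n \<mu>"
  shows "length \<mu> \<le> n"
proof -
  have "length \<mu> \<le> sum_list \<mu>" if "\<forall>p\<in>set \<mu>. p > 0" for \<mu> :: "nat list"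
    using that by (induction \<mu>) auto
  then show ?thesis using assms by (auto simp: is_partition_def)
qed

text \<open>Multiply the row identities over all rows. \<open>N\<close> may exceed the length, as
  empty rows have no boxes; so a diagram and the one with a box removed can be compared with the
  same number of rows.\<close>

lemma hook_product_frobenius:
  fixes \<mu> :: "nat list"
  assumes anti: "\<And>r s. 1 \<le> r \<Longrightarrow> r \<le> s \<Longrightarrow> part \<mu> s \<le> part \<mu> r" and len: "length \<mu> \<le> N"
  defines "a \<equiv> \<lambda>j. of_nat (part \<mu> j) - of_nat j :: 'a::field_char_0"
  shows "of_nat (hook_product \<mu>) * (\<Prod>i=1..N. \<Prod>k\<in>{i<..N}. a i - a k)
    = (\<Prod>i=1..N. fact (part \<mu> i + N - i))"
proof -
  have "part \<mu> r = 0" if "N < r" for r using that len by (simp add: part_def)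
  then have "hook_product \<mu> * (\<Prod>i=1..N. \<Prod>k\<in>{i<..N}. part \<mu> i + k - (part \<mu> k + i))
    = (\<Prod>i=1..N. fact (part \<mu> i + N - i))"
    using row_hook_complement[of "part \<mu>" N] anti
    by (simp add: hook_product_rows[OF len] hook_length_def conj_part_def flip: prod.distrib)
  then have "(of_nat (hook_product \<mu> * (\<Prod>i=1..N. \<Prod>k\<in>{i<..N}. part \<mu> i + k - (part \<mu> k + i))) :: 'a)
    = of_nat (\<Prod>i=1..N. fact (part \<mu> i + N - i))"
    by (rule arg_cong)
  \<comment> \<open>The natural subtraction does not truncate because the parts decrease.\<close>
  moreover have "of_nat (part \<mu> i + k - (part \<mu> k + i)) = a i - a k"
    if "i \<in> {1..N}" "k \<in> {i<..N}" for i k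
  proof -
    have "part \<mu> k + i \<le> part \<mu> i + k" using anti[of i k] that by auto
    then show ?thesis by (simp add: of_nat_diff a_def)
  qed
  then have "(\<Prod>i=1..N. \<Prod>k\<in>{i<..N}. of_nat (part \<mu> i + k - (part \<mu> k + i)))
      = (\<Prod>i=1..N. \<Prod>k\<in>{i<..N}. a i - a k)"
    by (intro prod.cong refl)
  ultimately show ?thesis by (simp del: One_nat_def)
qed

section \<open>Removing a box\<close>

text \<open>Lowering \<open>a i\<close> by one affects only the pairs containing \<open>i\<close>.
  The factor for the other member \<open>j\<close> does not depend on the order of the pair, since
  swapping changes the sign of both numerator and denominator.\<close>

lemma vandermonde_shift:
  fixes a :: "nat \<Rightarrow> 'a::field"
  assumes inj: "inj_on a {1..N}" and i: "i \<in> {1..N}"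
  defines "a' \<equiv> a(i := a i - 1)"
  shows "(\<Prod>r=1..N. \<Prod>k\<in>{r<..N}. a' r - a' k)
    = (\<Prod>r=1..N. \<Prod>k\<in>{r<..N}. a r - a k) * (\<Prod>j\<in>{1..N} - {i}. (a j + 1 - a i) / (a j - a i))"
proof -
  define w where "w = (\<lambda>j. (a j + 1 - a i) / (a j - a i))"
  define P where "P = Sigma {1..N} (\<lambda>r. {r<..N})"
  define v where "v = (\<lambda>(r, k). if r = i then w k else if k = i then w r else 1)"
  have step: "a' r - a' k = (a r - a k) * v (r, k)" if "(r, k) \<in> P" for r k
  proof -
    have "r \<in> {1..N}" "k \<in> {1..N}" "r \<noteq> k" using that by (auto simp: P_def)
    then have ne: "a r \<noteq> a k" using inj_onD[OF inj] by blast
    have w: "w j * (a j - a i) = a j + 1 - a i" if "a j \<noteq> a i" for j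
      using that by (simp add: w_def)
    consider "r = i" "k \<noteq> i" | "k = i" "r \<noteq> i" | "r \<noteq> i" "k \<noteq> i" using \<open>r \<noteq> k\<close> by blast
    then show ?thesis
    proof cases
      case 1
      have "(a i - a k) * w k = - (w k * (a k - a i))" by (simp add: algebra_simps)
      also have "\<dots> = - (a k + 1 - a i)" using w[of k] ne 1 by simp
      finally show ?thesis using 1 by (simp add: a'_def v_def)
    next
      case 2
      then show ?thesis using w[of r] ne by (simp add: a'_def v_def mult.commute)
    next
      case 3
      then show ?thesis by (simp add: a'_def v_def)
    qed
  qed
  have "(\<Prod>r=1..N. \<Prod>k\<in>{r<..N}. a' r - a' k) = (\<Prod>(r, k)\<in>P. a' r - a' k)"
    by (simp add: P_def prod.Sigma)
  also have "\<dots> = (\<Prod>(r, k)\<in>P. (a r - a k) * v (r, k))"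
    by (rule prod.cong) (auto simp: step)
  also have "\<dots> = (\<Prod>(r, k)\<in>P. a r - a k) * prod v P"
    by (simp add: prod.distrib case_prod_unfold)
  also have "(\<Prod>(r, k)\<in>P. a r - a k) = (\<Prod>r=1..N. \<Prod>k\<in>{r<..N}. a r - a k)"
    by (simp add: P_def prod.Sigma)
  also have "prod v P = prod v {(r, k) \<in> P. r = i \<or> k = i}"
    by (rule prod.mono_neutral_right) (auto simp: P_def v_def split: if_splits)
  \<comment> \<open>Pairs \<open>r < k\<close> containing \<open>i\<close> correspond to their other
    member.\<close>
  also have "\<dots> = prod w ({1..N} - {i})"
    by (rule prod.reindex_bij_witness[of _ "\<lambda>j. (min i j, max i j)" "\<lambda>(r, k). if r = i then k else r"])
       (use i in \<open>auto simp: P_def v_def min_def max_def split: if_splits\<close>)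
  finally show ?thesis by (simp add: w_def)
qed

lemma part_remove_box:
  assumes \<mu>: "is_partition n \<mu>" and i: "i \<in> removable_rows \<mu>"
  shows "part (remove_box \<mu> i) = (part \<mu>)(i := part \<mu> i - 1)"
proof -
  have len: "1 \<le> i" "i \<le> length \<mu>" and pi: "part \<mu> i > part \<mu> (i + 1)"
    using i by (auto simp: removable_rows_def part_def split: if_splits)
  have pos: "\<And>p. p \<in> set \<mu> \<Longrightarrow> p > 0" using \<mu> by (simp add: is_partition_def)
  show ?thesis
  proof (cases "part \<mu> i = 1")
    case False
    then have "part \<mu> i - 1 > 0" using pi by simp
    then have "\<forall>p\<in>set (\<mu>[i - 1 := part \<mu> i - 1]). p > 0"
      using pos set_update_subset_insert by fastforce
    then have "remove_box \<mu> i = \<mu>[i - 1 := part \<mu> i - 1]"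
      by (simp add: remove_box_def)
    then show ?thesis using len by (auto simp: part_def fun_eq_iff nth_list_update)
  next
    case True
    \<comment> \<open>A removable row of length 1 must be the last one, because listed parts are
      positive; \<open>filter\<close> then deletes only the final 0.\<close>
    then have "part \<mu> (i + 1) = 0" using pi by simp
    then have last: "i = length \<mu>"
      using len pos[of "\<mu> ! i"] nth_mem[of i \<mu>] by (cases "i = length \<mu>") (auto simp: part_def)
    have "\<mu>[i - 1 := 0] = butlast \<mu> @ [0]"
      using len last by (cases \<mu> rule: rev_cases) auto
    moreover have "filter (\<lambda>p. p > 0) (butlast \<mu>) = butlast \<mu>"
      using pos by (auto intro: filter_True dest: in_set_butlastD)
    ultimately have "remove_box \<mu> i = butlast \<mu>"
      by (simp add: remove_box_def True)
    then show ?thesis using last len True by (auto simp: part_def fun_eq_iff nth_butlast)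
  qed
qed

text \<open>The parts decrease weakly and \<open>- j\<close> decreases strictly.\<close>

lemma inj_shifted_parts:
  assumes "is_partition n \<mu>"
  shows "inj_on (\<lambda>j. of_nat (part \<mu> j) - of_nat j :: 'a::ring_char_0) {1..N}"
proof -
  have "of_nat (part \<mu> r) - of_nat r \<noteq> (of_nat (part \<mu> s) - of_nat s :: 'a)"
    if "1 \<le> r" "r < s" for r s
  proof
    assume "of_nat (part \<mu> r) - of_nat r = (of_nat (part \<mu> s) - of_nat s :: 'a)"
    then have "(of_nat (part \<mu> r + s) :: 'a) = of_nat (part \<mu> s + r)"
      by (simp add: algebra_simps)
    then have "part \<mu> r + s = part \<mu> s + r" by (simp only: of_nat_eq_iff)
    then show False using part_antimono[OF assms, of r s] that by simp
  qed
  then show ?thesis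
    by (intro linorder_inj_onI) auto
qed

text \<open>Divide Frobenius' formula for the two diagrams, both with \<open>n\<close> rows. The
  factorials differ only in row \<open>i\<close>, which gives \<open>a i + of_nat n\<close>; the
  Vandermonde products differ by the remaining product.\<close>

lemma hook_product_ratio:
  fixes \<mu> :: "nat list"
  assumes \<mu>: "is_partition n \<mu>" and i: "i \<in> removable_rows \<mu>"
  defines "a \<equiv> \<lambda>j. of_nat (part \<mu> j) - of_nat j :: 'a::field_char_0"
  shows "of_nat (hook_product \<mu>) / of_nat (hook_product (remove_box \<mu> i))
    = (a i + of_nat n) * (\<Prod>j\<in>{1..n} - {i}. (a j + 1 - a i) / (a j - a i))"
proof -
  define \<nu> where "\<nu> = remove_box \<mu> i"
  define D where "D = (\<lambda>a :: nat \<Rightarrow> 'a. \<Prod>r=1..n. \<Prod>k\<in>{r<..n}. a r - a k)"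
  define W where "W = (\<Prod>j\<in>{1..n} - {i}. (a j + 1 - a i) / (a j - a i))"
  have iI: "i \<in> {1..n}" and pi: "part \<mu> i > part \<mu> (i + 1)"
    using i \<mu> by (auto simp: removable_rows_def is_partition_def)
  have part\<nu>: "part \<nu> = (part \<mu>)(i := part \<mu> i - 1)"
    unfolding \<nu>_def by (rule part_remove_box[OF \<mu> i])
  note anti = part_antimono[OF \<mu>]
  have anti\<nu>: "part \<nu> s \<le> part \<nu> r" if "1 \<le> r" "r \<le> s" for r s
  \<comment> \<open>Only comparisons of row \<open>i\<close> with a lower row could fail after the
    removal; removability of \<open>i\<close> rules this out.\<close>
  proof (cases "r = i \<and> s \<noteq> i")
    case True
    then have "part \<mu> s \<le> part \<mu> (i + 1)" using that anti[of "i + 1" s] by simp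
    then show ?thesis using True pi by (simp add: part\<nu>)
  next
    case False
    then show ?thesis using anti[OF that] by (auto simp: part\<nu>)
  qed
  have len\<nu>: "length \<nu> \<le> n"
    using length_le_size[OF \<mu>] length_filter_le[of _ "\<mu>[i - 1 := part \<mu> i - 1]"]
    unfolding \<nu>_def remove_box_def by (metis le_trans length_list_update)
  have a\<nu>: "(\<lambda>j. of_nat (part \<nu> j) - of_nat j) = a(i := a i - 1)"
    using pi by (auto simp: part\<nu> a_def of_nat_diff)
  have shift: "D (a(i := a i - 1)) = D a * W"
    unfolding D_def W_def
    by (rule vandermonde_shift[OF _ iI]) (simp only: a_def inj_shifted_parts[OF \<mu>])
  have H: "of_nat (hook_product \<mu>) * D a = (\<Prod>r=1..n. fact (part \<mu> r + n - r))"
    using hook_product_frobenius[OF anti length_le_size[OF \<mu>], where 'a='a]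
    by (simp add: D_def a_def)
  have H\<nu>: "of_nat (hook_product \<nu>) * D (a(i := a i - 1)) = (\<Prod>r=1..n. fact (part \<nu> r + n - r))"
    using hook_product_frobenius[OF anti\<nu> len\<nu>, where 'a='a]
    unfolding D_def a\<nu>[symmetric] .
  have "fact (part \<mu> i + n - i) = (a i + of_nat n) * (fact (part \<nu> i + n - i) :: 'a)"
  proof -
    obtain m where m: "part \<mu> i + n - i = Suc m" using pi iI by (cases "part \<mu> i + n - i") auto
    then have "part \<nu> i + n - i = m" using pi by (simp add: part\<nu>)
    moreover have "a i + of_nat n = of_nat (part \<mu> i + n - i)"
      using iI by (simp add: a_def of_nat_diff)
    ultimately show ?thesis by (simp only: m fact_Suc)
  qed
  then have "(\<Prod>r=1..n. fact (part \<mu> r + n - r) :: 'a)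
      = (a i + of_nat n) * (\<Prod>r=1..n. fact (part \<nu> r + n - r))"
    using iI by (simp add: prod.remove[of _ i] part\<nu>)
  then have key: "of_nat (hook_product \<mu>) * D a
      = (a i + of_nat n) * W * of_nat (hook_product \<nu>) * D a"
    using H H\<nu> shift by (simp add: mult_ac)
  \<comment> \<open>Factorials are nonzero in characteristic 0, so by Frobenius' formula both
    \<open>D a\<close> and the smaller hook product are nonzero and may be cancelled.\<close>
  have nz: "(\<Prod>r=1..n. fact (f r) :: 'a) \<noteq> 0" for f :: "nat \<Rightarrow> nat" by simp
  have "of_nat (hook_product \<mu>) * D a \<noteq> 0" unfolding H by (rule nz)
  then have "D a \<noteq> 0" by auto
  moreover have "of_nat (hook_product \<nu>) * D (a(i := a i - 1)) \<noteq> 0" unfolding H\<nu> by (rule nz)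
  then have "(of_nat (hook_product \<nu>) :: 'a) \<noteq> 0" by auto
  ultimately show ?thesis
    using key unfolding \<nu>_def W_def by (simp add: divide_eq_eq)
qed

text \<open>Rows \<open>i\<close> and \<open>i + 1\<close> have equal length, so the factor at
  \<open>j = i + 1\<close> is zero. For \<open>i = n\<close> that index is out of range, but then
  row \<open>n\<close> is empty and \<open>a n + of_nat n\<close> is zero.\<close>

lemma shifted_factor_vanishes:
  fixes \<mu> :: "nat list"
  assumes \<mu>: "is_partition n \<mu>" and i: "i \<in> {1..n} - removable_rows \<mu>"
  defines "a \<equiv> \<lambda>j. of_nat (part \<mu> j) - of_nat j :: 'a::field"
  shows "(a i + of_nat n) * (\<Prod>j\<in>{1..n} - {i}. (a j + 1 - a i) / (a j - a i)) = 0"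
proof -
  have eq: "part \<mu> (i + 1) = part \<mu> i"
    using \<mu> i part_antimono[OF \<mu>, of i "i + 1"] by (auto simp: removable_rows_def is_partition_def)
  show ?thesis
  proof (cases "i = n")
    case True
    have "part \<mu> (n + 1) = 0" using length_le_size[OF \<mu>] by (simp add: part_def)
    then show ?thesis using True eq by (simp add: a_def)
  next
    case False
    then have "i + 1 \<in> {1..n} - {i}" using i by auto
    moreover have "a (i + 1) + 1 - a i = 0" using eq by (simp add: a_def)
    ultimately have "(\<Prod>j\<in>{1..n} - {i}. (a j + 1 - a i) / (a j - a i)) = 0"
      by (intro prod_zero) (auto intro!: bexI[of _ "i + 1"])
    then show ?thesis by simp
  qed
qed

section \<open>The identity of rational functions\<close>

text \<open>This is the identity at any point \<open>x\<close> that is not a pole, over any field of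
  characteristic 0. The rational function field with \<open>x = indet\<close> is one
  instance.\<close>

lemma hook_ratio_sum:
  fixes x :: "'a::field_char_0"
  assumes \<mu>: "is_partition n \<mu>"
    and x: "\<And>i. i \<in> {1..n} \<Longrightarrow> x + of_nat (part \<mu> i) - of_nat i \<noteq> 0"
  shows "(\<Sum>i\<in>removable_rows \<mu>.
            (of_nat (hook_product \<mu>) / of_nat (hook_product (remove_box \<mu> i)))
              * (1 / (x + of_nat (part \<mu> i) - of_nat i)))
         = x - (x - of_nat n) * g_poly \<mu> (x + 1) / g_poly \<mu> x"
proof -
  define a where "a = (\<lambda>j. of_nat (part \<mu> j) - of_nat j :: 'a)"
  define c where "c = (\<lambda>i. \<Prod>j\<in>{1..n} - {i}. (a j + 1 - a i) / (a j - a i))"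
  have xa: "x + of_nat (part \<mu> i) - of_nat i = x + a i" for i by (simp add: a_def)
  have nz: "x + a i \<noteq> 0" if "i \<in> {1..n}" for i using x[OF that] by (simp add: xa)
  have size: "sum_list \<mu> = n" using \<mu> by (simp add: is_partition_def)
  \<comment> \<open>For \<open>b = a + 1\<close> the factor \<open>j = i\<close> of the numerator is
    1.\<close>
  have c_eq: "(\<Prod>j\<in>{1..n}. a j + 1 - a i) / (\<Prod>j\<in>{1..n} - {i}. a j - a i) = c i"
    if "i \<in> {1..n}" for i
    using that by (simp add: c_def prod_dividef prod.remove[of _ i])
  have inj: "inj_on a {1..n}" unfolding a_def by (rule inj_shifted_parts[OF \<mu>])
  note pf = partial_fractions_monic[OF finite_atLeastAtMost inj, of "\<lambda>j. a j + 1"]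
  have quot: "(\<Prod>i=1..n. (x + (a i + 1)) / (x + a i)) = 1 + (\<Sum>i=1..n. c i / (x + a i))"
    using conjunct1[OF pf, rule_format, of x] nz by (simp add: c_eq del: One_nat_def)
  \<comment> \<open>Each \<open>b i - a i\<close> is 1. This total later cancels the constant in
    \<open>x - of_nat n\<close>, so that only polar terms remain.\<close>
  have total: "(\<Sum>i=1..n. c i) = of_nat n"
    using conjunct2[OF pf] by (simp add: c_eq del: One_nat_def)
  have "g_poly \<mu> (x + 1) / g_poly \<mu> x = (\<Prod>i=1..n. (x + (a i + 1)) / (x + a i))"
    by (simp add: g_poly_def size a_def algebra_simps flip: prod_dividef)
  then have "(x - of_nat n) * g_poly \<mu> (x + 1) / g_poly \<mu> x
      = (x - of_nat n) + (\<Sum>i=1..n. (x - of_nat n) * (c i / (x + a i)))"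
    by (simp add: quot distrib_left sum_distrib_left del: One_nat_def times_divide_eq_right
        flip: times_divide_eq_right)
  \<comment> \<open>Write \<open>x - of_nat n\<close> as
    \<open>(x + a i) - (a i + of_nat n)\<close>.\<close>
  also have "(\<Sum>i=1..n. (x - of_nat n) * (c i / (x + a i)))
      = (\<Sum>i=1..n. c i - (a i + of_nat n) * c i / (x + a i))"
    by (rule sum.cong) (use nz in \<open>auto simp: field_simps\<close>)
  also have "\<dots> = of_nat n - (\<Sum>i=1..n. (a i + of_nat n) * c i / (x + a i))"
    by (simp add: sum_subtractf total del: One_nat_def)
  finally have rhs: "x - (x - of_nat n) * g_poly \<mu> (x + 1) / g_poly \<mu> x
      = (\<Sum>i=1..n. (a i + of_nat n) * c i / (x + a i))" by simp
  have "(\<Sum>i\<in>removable_rows \<mu>.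
            (of_nat (hook_product \<mu>) / of_nat (hook_product (remove_box \<mu> i)))
              * (1 / (x + of_nat (part \<mu> i) - of_nat i)))
      = (\<Sum>i\<in>removable_rows \<mu>. (a i + of_nat n) * c i / (x + a i))"
    unfolding c_def xa
    by (intro sum.cong refl) (simp add: hook_product_ratio[OF \<mu>] a_def)
  also have "\<dots> = (\<Sum>i=1..n. (a i + of_nat n) * c i / (x + a i))"
  proof (rule sum.mono_neutral_left)
    show "removable_rows \<mu> \<subseteq> {1..n}" by (auto simp: removable_rows_def size)
    show "\<forall>i\<in>{1..n} - removable_rows \<mu>. (a i + of_nat n) * c i / (x + a i) = 0"
      using shifted_factor_vanishes[OF \<mu>, where 'a='a] unfolding c_def a_def by simp
  qed simp
  finally show ?thesis using rhs by simp
qed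

text \<open>The denominators are the indeterminate plus an integer. As polynomials they have linear
  coefficient 1, so the indeterminate is not a pole.\<close>

lemma indet_plus_of_int_nonzero: "indet + of_int k \<noteq> 0"
proof
  assume "indet + of_int k = 0"
  moreover have "of_int k = Fract (of_int k :: rat poly) 1"
    by (cases k rule: int_cases2) (simp_all add: of_nat_fract)
  ultimately have "([:0, 1:] + of_int k :: rat poly) = 0"
    by (simp add: indet_def Zero_fract_def eq_fract)
  then have "coeff ([:0, 1:] + of_int k :: rat poly) 1 = 0" by simp
  then show False by (simp add: of_int_poly)
qed

theorem theorem4p1:
  fixes n :: nat and \<mu> :: "nat list"
  assumes "n \<ge> 1" and "is_partition n \<mu>"
  shows "(\<Sum>i\<in>removable_rows \<mu>.
            (of_nat (hook_product \<mu>) / of_nat (hook_product (remove_box \<mu> i)))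
              * (1 / (indet + of_nat (part \<mu> i) - of_nat i)))
         = indet - (indet - of_nat n) * g_poly \<mu> (indet + 1) / g_poly \<mu> indet"
proof (rule hook_ratio_sum[OF assms(2)])
  show "indet + of_nat (part \<mu> i) - of_nat i \<noteq> 0" for i
    using indet_plus_of_int_nonzero[of "int (part \<mu> i) - int i"] by (simp add: algebra_simps)
qed

end
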